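(* Let $T$ and $T'$ be spiders with ${\mathbf S}_T(q,r)={\mathbf S}_{T'}(q,r)$. Then $T$ and $T'$ are isomorphic. (That is, a spider $T_\lambda$, $\lambda\vdash n-1$ with $\ell(\lambda)\geq 3$, can be reconstructed from its subtree polynomial.)
   Context: A spider is a tree with exactly one vertex of degree $\geq 3$ (the torso); equivalently, a collection of edge-disjoint paths (legs) sharing a common endpoint. For a partition $\lambda\vdash n-1$ with $\ell(\lambda)\ge 3$ parts, $T_\lambda$ is the spider on $n$ vertices whose leg lengths (numbers of edges) are the parts of $\lambda$. The subtree polynomial of a tree $T$ is ${\mathbf S}_T(q,r)=\sum_S q^{\#S} r^{\#L(S)}$, summed over all subtrees $S$ with at least one edge, where $\#S$ is the number of edges of $S$ and $L(S)$ its set of leaf edges (edges incident to a vertex of degree 1 in $S$). *)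

theory Defs
  imports "HOL-Computational_Algebra.Polynomial"
begin

record 'a ugraph =
  verts :: "'a set"
  edges :: "'a set set"

definition simple_graph :: "'a ugraph \<Rightarrow> bool" where
  "simple_graph G \<longleftrightarrow>
     finite (verts G) \<and> (\<forall>e\<in>edges G. e \<subseteq> verts G \<and> card e = 2)"

definition vdegree :: "'a ugraph \<Rightarrow> 'a \<Rightarrow> nat" where
  "vdegree G v = card {e \<in> edges G. v \<in> e}"

definition graph_connected :: "'a ugraph \<Rightarrow> bool" where
  "graph_connected G \<longleftrightarrow> verts G \<noteq> {} \<and>
     (\<forall>u\<in>verts G. \<forall>v\<in>verts G. (u, v) \<in> {(x, y). {x, y} \<in> edges G}\<^sup>*)"

definition graph_cycle :: "'a ugraph \<Rightarrow> 'a list \<Rightarrow> bool" where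
  "graph_cycle G p \<longleftrightarrow> 3 \<le> length p \<and> distinct p \<and>
     (\<forall>i<length p. {p ! i, p ! (Suc i mod length p)} \<in> edges G)"

definition tree :: "'a ugraph \<Rightarrow> bool" where
  "tree G \<longleftrightarrow> simple_graph G \<and> graph_connected G \<and> (\<nexists>p. graph_cycle G p)"

definition spider :: "'a ugraph \<Rightarrow> bool" where
  "spider T \<longleftrightarrow> tree T \<and> (\<exists>!v. v \<in> verts T \<and> 3 \<le> vdegree T v)"

definition graph_isomorphic :: "'a ugraph \<Rightarrow> 'b ugraph \<Rightarrow> bool" where
  "graph_isomorphic G H \<longleftrightarrow> (\<exists>f. bij_betw f (verts G) (verts H) \<and>
     (\<forall>u\<in>verts G. \<forall>v\<in>verts G. {u, v} \<in> edges G \<longleftrightarrow> {f u, f v} \<in> edges H))"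

definition subtree :: "'a ugraph \<Rightarrow> 'a ugraph \<Rightarrow> bool" where
  "subtree S T \<longleftrightarrow> verts S \<subseteq> verts T \<and> edges S \<subseteq> edges T \<and> tree S"

definition leaf_edges :: "'a ugraph \<Rightarrow> 'a set set" where
  "leaf_edges S = {e \<in> edges S. \<exists>v\<in>e. vdegree S v = 1}"

text \<open>A polynomial in \<open>q\<close> (outer variable) whose coefficients are integer
  polynomials in \<open>r\<close> (inner variable).\<close>

definition subtree_poly :: "'a ugraph \<Rightarrow> int poly poly" where
  "subtree_poly T = (\<Sum>S | subtree S T \<and> edges S \<noteq> {}.
     monom (monom 1 (card (leaf_edges S))) (card (edges S)))"

text \<open>The sum above ranges over a finite set, so it is not degenerate.\<close>

lemma finite_subtrees:
  assumes "tree T"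
  shows "finite {S. subtree S T \<and> edges S \<noteq> {}}"
proof -
  have fV: "finite (verts T)" and E: "edges T \<subseteq> Pow (verts T)"
    using assms by (auto simp: tree_def simple_graph_def)
  have "finite (edges T)"
    using E fV by (meson finite_Pow_iff finite_subset)
  then have fin: "finite (Pow (verts T) \<times> Pow (edges T))"
    using fV by simp
  have "{S. subtree S T \<and> edges S \<noteq> {}} \<subseteq>
      (\<lambda>(V, E). \<lparr>verts = V, edges = E\<rparr>) ` (Pow (verts T) \<times> Pow (edges T))"
  proof
    fix S assume "S \<in> {S. subtree S T \<and> edges S \<noteq> {}}"
    then have "(verts S, edges S) \<in> Pow (verts T) \<times> Pow (edges T)"
      by (simp add: subtree_def)
    moreover have "S = (\<lambda>(V, E). \<lparr>verts = V, edges = E\<rparr>) (verts S, edges S)"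
      by simp
    ultimately show "S \<in> (\<lambda>(V, E). \<lparr>verts = V, edges = E\<rparr>) ` (Pow (verts T) \<times> Pow (edges T))"
      by (rule rev_image_eqI)
  qed
  then show ?thesis
    using fin by (meson finite_imageI finite_subset)
qed

end

theory Submission
  imports Defs "HOL-Combinatorics.Permutations"
begin

text \<open>Let the spider have \<open>l \<ge> 3\<close> legs of lengths \<open>L\<^sub>1, \<dots>, L\<^sub>l\<close>. No subtree has more than
  \<open>l\<close> leaf edges, and the subtrees with exactly \<open>l\<close> of them are obtained by cutting every leg \<open>i\<close>
  to a length \<open>1 \<le> a\<^sub>i \<le> L\<^sub>i\<close>. So \<open>l\<close> is the degree of the subtree polynomial in \<open>r\<close>, and the
  coefficient of its highest power of \<open>r\<close> is the product of the \<open>q + \<dots> + q^L\<^sub>i = q (1 - q^L\<^sub>i) / (1 - q)\<close>.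
  The product of the \<open>1 - q^L\<^sub>i\<close> determines the multiset of the \<open>L\<^sub>i\<close>: the smallest exponent and
  its multiplicity can be read off the lowest nonconstant term, and one cancels and repeats.\<close>

section \<open>Trees\<close>

lemma edge_distinct:
  assumes "simple_graph G" "{x, y} \<in> edges G"
  shows "x \<noteq> y"
  using assms by (auto simp: simple_graph_def)

lemma edge_in_verts:
  assumes "simple_graph G" "{x, y} \<in> edges G"
  shows "x \<in> verts G" "y \<in> verts G"
  using assms by (auto simp: simple_graph_def)

lemma finite_edges:
  assumes "simple_graph G"
  shows "finite (edges G)"
proof (rule finite_subset)
  show "edges G \<subseteq> Pow (verts G)" "finite (Pow (verts G))"
    using assms by (auto simp: simple_graph_def)
qed

text \<open>A walk is built one step at a time; when the next vertex already lies on the list, the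
  list is cut back to it, which keeps the entries distinct.\<close>

lemma rtrancl_imp_distinct_list:
  assumes "(u, v) \<in> r\<^sup>*"
  obtains xs where "xs \<noteq> []" "distinct xs" "hd xs = u" "last xs = v"
    "\<And>i. Suc i < length xs \<Longrightarrow> (xs ! i, xs ! Suc i) \<in> r"
proof -
  from assms have "\<exists>xs. xs \<noteq> [] \<and> distinct xs \<and> hd xs = u \<and> last xs = v \<and>
      (\<forall>i. Suc i < length xs \<longrightarrow> (xs ! i, xs ! Suc i) \<in> r)"
  proof (induction rule: rtrancl_induct)
    case base
    show ?case by (rule exI[of _ "[u]"]) simp
  next
    case (step y z)
    then obtain xs where xs: "xs \<noteq> []" "distinct xs" "hd xs = u" "last xs = y"
      "\<And>i. Suc i < length xs \<Longrightarrow> (xs ! i, xs ! Suc i) \<in> r" by blast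
    show ?case
    proof (cases "z \<in> set xs")
      case True
      then obtain k where k: "k < length xs" "xs ! k = z"
        by (auto simp: in_set_conv_nth)
      show ?thesis
        using xs k by (intro exI[of _ "take (Suc k) xs"]) (auto simp: last_conv_nth)
    next
      case False
      have "((xs @ [z]) ! i, (xs @ [z]) ! Suc i) \<in> r" if "Suc i < length (xs @ [z])" for i
      proof (cases "Suc i < length xs")
        case True
        then show ?thesis using xs(5) by (simp add: nth_append)
      next
        case False
        with that have "i = length xs - 1" using xs(1) by simp
        then show ?thesis
          using xs(1,4) step(2) by (simp add: nth_append last_conv_nth)
      qed
      with xs False show ?thesis by (intro exI[of _ "xs @ [z]"]) auto
    qed
  qed
  with that show ?thesis by blast
qed

text \<open>An edge outside \<open>E\<close> would close the repetition-free path in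
  \<open>E\<close> between its ends to a cycle. That path has at least three vertices, since with
  only two it would consist of the missing edge itself.\<close>

lemma acyclic_connected_subset_edges:
  assumes simple: "simple_graph G" and acyclic: "\<nexists>p. graph_cycle G p"
    and sub: "E \<subseteq> edges G"
    and conn: "\<And>u v. u \<in> verts G \<Longrightarrow> v \<in> verts G \<Longrightarrow> (u, v) \<in> {(x, y). {x, y} \<in> E}\<^sup>*"
  shows "E = edges G"
proof (rule ccontr)
  assume "E \<noteq> edges G"
  with sub obtain e where e: "e \<in> edges G" "e \<notin> E" by blast
  with simple have "card e = 2" by (auto simp: simple_graph_def)
  then obtain u v where uv: "e = {u, v}" "u \<noteq> v" by (auto simp: card_2_iff)
  have "u \<in> verts G" "v \<in> verts G"
    using edge_in_verts[OF simple] e uv by blast+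
  from rtrancl_imp_distinct_list[OF conn[OF this]]
  obtain xs where xs: "xs \<noteq> []" "distinct xs" "hd xs = u" "last xs = v"
    and step: "\<And>i. Suc i < length xs \<Longrightarrow> {xs ! i, xs ! Suc i} \<in> E" by auto
  have ends: "xs ! 0 = u" "xs ! (length xs - 1) = v"
    using xs by (simp_all add: hd_conv_nth last_conv_nth)
  have "length xs \<noteq> 1" using ends uv(2) by auto
  moreover have "length xs \<noteq> 2"
    using step[of 0] ends e(2) uv(1) by auto
  ultimately have len: "3 \<le> length xs"
    using xs(1) by (cases "length xs" rule: nat.exhaust) (auto simp: le_Suc_eq)
  have "{xs ! i, xs ! (Suc i mod length xs)} \<in> edges G" if "i < length xs" for i
  proof (cases "Suc i < length xs")
    case True
    then show ?thesis using step sub by auto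
  next
    case False
    with that have "Suc i = length xs" "i = length xs - 1" by auto
    then show ?thesis using ends e(1) uv(1) by (simp add: insert_commute)
  qed
  with len xs(2) have "graph_cycle G xs" by (simp add: graph_cycle_def)
  with acyclic show False by blast
qed

text \<open>This is the tool for confining a connected graph to a region: it suffices that no edge
  leaves the region.\<close>

lemma connected_closed_subset:
  assumes "graph_connected G" "u \<in> verts G" "u \<in> X"
    and closed: "\<And>x y. x \<in> X \<Longrightarrow> {x, y} \<in> edges G \<Longrightarrow> y \<in> X"
  shows "verts G \<subseteq> X"
proof
  fix v assume "v \<in> verts G"
  with assms(1,2) have "(u, v) \<in> {(x, y). {x, y} \<in> edges G}\<^sup>*"
    by (auto simp: graph_connected_def)
  then show "v \<in> X"
    by (induction rule: rtrancl_induct) (use assms(3) closed in auto)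
qed

lemma vdegree_1_unique:
  assumes "vdegree G v = 1" "{v, x} \<in> edges G" "{v, y} \<in> edges G"
  shows "x = y"
proof -
  from assms(1) obtain e where e: "{e \<in> edges G. v \<in> e} = {e}"
    by (auto simp: vdegree_def card_1_singleton_iff)
  have "{v, x} \<in> {e \<in> edges G. v \<in> e}" "{v, y} \<in> {e \<in> edges G. v \<in> e}"
    using assms by auto
  then have "{v, x} = {v, y}" unfolding e by simp
  then show ?thesis by (auto simp: doubleton_eq_iff)
qed

lemma vdegree_ge_3:
  assumes "simple_graph G" "{u, x} \<in> edges G" "{u, y} \<in> edges G" "{u, z} \<in> edges G"
    and "x \<noteq> y" "y \<noteq> z" "x \<noteq> z"
  shows "3 \<le> vdegree G u"
proof -
  have "card {{u, x}, {u, y}, {u, z}} = 3"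
    using assms(5-7) by (auto simp: doubleton_eq_iff card_insert_if)
  moreover have "card {{u, x}, {u, y}, {u, z}} \<le> card {e \<in> edges G. u \<in> e}"
    using assms finite_edges[OF assms(1)] by (intro card_mono) auto
  ultimately show ?thesis by (simp add: vdegree_def)
qed

section \<open>A product of factors \<open>1 - x^n\<close> determines its exponents\<close>

lemma coeff_one_minus_monom_mult:
  fixes P :: "'a::comm_ring_1 poly"
  shows "coeff ((1 - monom 1 n) * P) k = coeff P k - (if n \<le> k then coeff P (k - n) else 0)"
  by (simp add: left_diff_distrib coeff_monom_mult)

text \<open>Up to degree \<open>m\<close> only the factors with exponent exactly \<open>m\<close>
  contribute, each of them \<open>-1\<close> at degree \<open>m\<close>; products of two nonconstant
  terms have degree at least \<open>2 * m\<close>, which exceeds \<open>m\<close>.\<close>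

lemma coeff_prod_one_minus_monom:
  fixes A :: "nat multiset"
  assumes "\<And>n. n \<in># A \<Longrightarrow> m \<le> n" "0 < m" "k \<le> m"
  shows "coeff (\<Prod>n\<in>#A. 1 - monom 1 n :: int poly) k =
    (if k = 0 then 1 else if k = m then - int (count A m) else 0)"
  using assms
proof (induction A arbitrary: k)
  case empty
  then show ?case by simp
next
  case (add n A)
  then have "m \<le> n" "\<And>n. n \<in># A \<Longrightarrow> m \<le> n" by simp_all
  \<comment> \<open>The new factor subtracts the coefficient at \<open>k - n\<close>. As
    \<open>m \<le> n\<close> and \<open>k \<le> m\<close>, this happens only for
    \<open>n = m = k\<close>, so only index 0 is needed besides \<open>k\<close>.\<close>
  then show ?case
    using add.IH[of k] add.IH[of 0] add.prems(2,3) by (auto simp: coeff_one_minus_monom_mult)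
qed

text \<open>Exponent 0 has to be excluded because its factor is 0 and would wipe out the whole
  product.\<close>

lemma prod_one_minus_monom_inject:
  fixes A B :: "nat multiset"
  assumes "(\<Prod>n\<in>#A. 1 - monom 1 n :: int poly) = (\<Prod>n\<in>#B. 1 - monom 1 n)"
    and "0 \<notin># A" "0 \<notin># B"
  shows "A = B"
  using assms
proof (induction "size A" arbitrary: A B rule: less_induct)
  case less
  show ?case
  proof (cases "A + B = {#}")
    case True
    then show ?thesis by simp
  next
    case False
    \<comment> \<open>The minimum is taken over both multisets together, so the coefficient lemma
      applies to each of them; equal counts then put \<open>m\<close> into both.\<close>
    define m where "m = Min (set_mset (A + B))"
    have mem: "m \<in># A + B" unfolding m_def using False by (intro Min_in) auto
    then have pos: "0 < m" using less.prems by (auto intro: Suc_leI gr0I)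
    have "m \<le> n" if "n \<in># A + B" for n
      unfolding m_def using that by (intro Min_le) auto
    then have le: "\<And>n. n \<in># A \<Longrightarrow> m \<le> n" "\<And>n. n \<in># B \<Longrightarrow> m \<le> n" by auto
    have "count A m = count B m"
      using coeff_prod_one_minus_monom[OF le(1) pos, of A m]
        coeff_prod_one_minus_monom[OF le(2) pos, of B m] less.prems(1) pos by simp
    with mem have "m \<in># A" "m \<in># B"
      by (metis count_eq_zero_iff union_iff)+
    then obtain A' B' where AB: "A = add_mset m A'" "B = add_mset m B'"
      by (metis multi_member_split)
    have "coeff (1 - monom 1 m :: int poly) 0 \<noteq> 0" using pos by simp
    then have nz: "1 - monom 1 m \<noteq> (0 :: int poly)" by (metis coeff_0)
    have "A' = B'"
    proof (rule less.hyps)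
      show "(\<Prod>n\<in>#A'. 1 - monom 1 n :: int poly) = (\<Prod>n\<in>#B'. 1 - monom 1 n)"
        using less.prems(1) nz unfolding AB by simp
    qed (use less.prems AB in auto)
    with AB show ?thesis by simp
  qed
qed

section \<open>Spiders in leg coordinates\<close>

text \<open>The vertex \<open>p i j\<close> is at distance \<open>j\<close> from the torso on leg \<open>i\<close>; the torso is \<open>p i 0\<close> for every \<open>i\<close>.\<close>

definition leg_coords :: "nat \<Rightarrow> (nat \<Rightarrow> nat) \<Rightarrow> (nat \<Rightarrow> nat \<Rightarrow> 'a) \<Rightarrow> bool" where
  "leg_coords l L p \<longleftrightarrow> (\<forall>i<l. \<forall>i'<l. \<forall>j\<le>L i. \<forall>j'\<le>L i'.
     p i j = p i' j' \<longleftrightarrow> j = j' \<and> (i = i' \<or> j = 0))"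

text \<open>With \<open>a = L\<close> this is the whole spider, with smaller values the spider with
  its legs cut, so one family describes both.\<close>

definition leg_graph :: "nat \<Rightarrow> (nat \<Rightarrow> nat \<Rightarrow> 'a) \<Rightarrow> (nat \<Rightarrow> nat) \<Rightarrow> 'a ugraph" where
  "leg_graph l p a = \<lparr>verts = {p i j | i j. i < l \<and> j \<le> a i},
     edges = {{p i j, p i (Suc j)} | i j. i < l \<and> j < a i}\<rparr>"

lemma leg_graph_verts: "verts (leg_graph l p a) = {p i j | i j. i < l \<and> j \<le> a i}"
  and leg_graph_edges: "edges (leg_graph l p a) = {{p i j, p i (Suc j)} | i j. i < l \<and> j < a i}"
  by (simp_all add: leg_graph_def)

lemma leg_coordsD:
  assumes "leg_coords l L p" "i < l" "i' < l" "j \<le> L i" "j' \<le> L i'"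
  shows "p i j = p i' j' \<longleftrightarrow> j = j' \<and> (i = i' \<or> j = 0)"
  using assms unfolding leg_coords_def by blast

lemma leg_graph_path_to_torso:
  assumes "i < l" "j \<le> a i"
  shows "(p i j, p i 0) \<in> {(x, y). {x, y} \<in> edges (leg_graph l p a)}\<^sup>*"
  using assms(2)
proof (induction j)
  case (Suc j)
  then have "(p i (Suc j), p i j) \<in> {(x, y). {x, y} \<in> edges (leg_graph l p a)}"
    using assms(1) by (auto simp: leg_graph_edges insert_commute intro!: exI)
  with Suc show ?case by (auto intro: converse_rtrancl_into_rtrancl)
qed simp

lemma leg_graph_connected_pair:
  assumes "leg_coords l L p" "u \<in> verts (leg_graph l p a)" "v \<in> verts (leg_graph l p a)"
  shows "(u, v) \<in> {(x, y). {x, y} \<in> edges (leg_graph l p a)}\<^sup>*"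
proof -
  let ?r = "{(x, y). {x, y} \<in> edges (leg_graph l p a)}"
  obtain i j i' j' where ij: "u = p i j" "i < l" "j \<le> a i" "v = p i' j'" "i' < l" "j' \<le> a i'"
    using assms by (auto simp: leg_graph_verts)
  have "sym (?r\<^sup>*)"
    by (intro sym_rtrancl symI) (simp add: insert_commute)
  moreover have "(p i' j', p i' 0) \<in> ?r\<^sup>*" "(p i j, p i 0) \<in> ?r\<^sup>*"
    using leg_graph_path_to_torso ij by metis+
  moreover have "p i 0 = p i' 0"
    using leg_coordsD[OF assms(1)] ij by blast
  ultimately show ?thesis
    unfolding ij(1,4) by (auto dest: symD intro: rtrancl_trans)
qed

text \<open>This replaces the degree condition on spiders by explicit data;
  \<open>spider_has_coords\<close> provides such data for every spider.\<close>

locale spider_coords =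
  fixes T :: "'a ugraph" and l :: nat and L :: "nat \<Rightarrow> nat" and p :: "nat \<Rightarrow> nat \<Rightarrow> 'a"
  assumes tree: "tree T" and legs: "3 \<le> l" and pos: "i < l \<Longrightarrow> 1 \<le> L i"
    and coords: "leg_coords l L p" and T_eq: "T = leg_graph l p L"
begin

lemma p_eq [simp]:
  assumes "i < l" "i' < l" "j \<le> L i" "j' \<le> L i'"
  shows "p i j = p i' j' \<longleftrightarrow> j = j' \<and> (i = i' \<or> j = 0)"
  using leg_coordsD[OF coords assms] .

lemma edge_cases:
  assumes "{x, y} \<in> edges T"
  obtains i j where "i < l" "j < L i" "x = p i j" "y = p i (Suc j)"
    | i j where "i < l" "j < L i" "y = p i j" "x = p i (Suc j)"
  using assms unfolding T_eq leg_graph_edges by (auto simp: doubleton_eq_iff)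

lemma leg_edge_in_T: "i < l \<Longrightarrow> j < L i \<Longrightarrow> {p i j, p i (Suc j)} \<in> edges T"
  unfolding T_eq leg_graph_edges by blast

lemma leg_edge_eq:
  assumes "i < l" "i' < l" "j < L i" "j' < L i'"
  shows "{p i j, p i (Suc j)} = {p i' j', p i' (Suc j')} \<longleftrightarrow> i = i' \<and> j = j'"
  using assms by (auto simp: doubleton_eq_iff)

lemma edge_at_inner:
  assumes "{p i j, y} \<in> edges T" "i < l" "j \<le> L i" "0 < j"
  shows "y = p i (j - 1) \<or> j < L i \<and> y = p i (Suc j)"
  using assms(1) by (cases rule: edge_cases) (use assms in auto)

section \<open>Confining a subtree by its leaves\<close>

lemma subtree_facts:
  assumes "subtree S T"
  shows "simple_graph S" "graph_connected S" "edges S \<subseteq> edges T" "verts S \<subseteq> verts T"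
  using assms by (auto simp: subtree_def tree_def)

lemma subtree_edge_verts:
  assumes "subtree S T" "{x, y} \<in> edges S"
  shows "x \<in> verts S" "y \<in> verts S"
  using edge_in_verts[OF subtree_facts(1)[OF assms(1)] assms(2)] .

lemma subtree_verts_cases:
  assumes "subtree S T" "v \<in> verts S"
  obtains i j where "i < l" "j \<le> L i" "v = p i j"
  using subtree_facts(4)[OF assms(1)] assms(2) unfolding T_eq leg_graph_verts by blast

text \<open>A leaf at the outer end of an edge is a dead end: the region made of the other legs and
  of leg \<open>i\<close> up to the leaf can be left only through a second edge at the leaf.\<close>

lemma outer_leaf_bound:
  assumes S: "subtree S T" and ij: "i < l" "j < L i" "{p i j, p i (Suc j)} \<in> edges S"
    and deg: "vdegree S (p i (Suc j)) = 1"
    and k: "k \<le> L i" "p i k \<in> verts S"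
  shows "k \<le> Suc j"
proof -
  let ?X = "{p i' j' | i' j'. i' < l \<and> j' \<le> L i' \<and> (i' = i \<longrightarrow> j' \<le> Suc j)}"
  have "verts S \<subseteq> ?X"
  proof (rule connected_closed_subset)
    show "graph_connected S" by (rule subtree_facts[OF S])
    show "p i j \<in> verts S" using subtree_edge_verts[OF S ij(3)] by blast
    show "p i j \<in> ?X" using ij by fastforce
  next
    fix x y assume x: "x \<in> ?X" and xy: "{x, y} \<in> edges S"
    then have "{x, y} \<in> edges T" using subtree_facts[OF S] by blast
    then show "y \<in> ?X"
    proof (cases rule: edge_cases)
      case (1 i' j')
      show ?thesis
      proof (cases "i' = i \<and> j' = Suc j")
        \<comment> \<open>This edge would lead past the leaf. Degree 1 identifies its far end with
          \<open>p i j\<close>, although the two lie at different distances from the torso.\<close>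
        case True
        then have "{p i (Suc j), p i (Suc (Suc j))} \<in> edges S" using 1 xy by simp
        moreover have "{p i (Suc j), p i j} \<in> edges S" using ij by (simp add: insert_commute)
        ultimately have "p i (Suc (Suc j)) = p i j" using vdegree_1_unique[OF deg] by blast
        then show ?thesis using True 1 ij by simp
      next
        case False
        have "i' = i \<longrightarrow> j' \<le> Suc j"
        proof
          assume "i' = i"
          with x 1 show "j' \<le> Suc j" by auto
        qed
        with False 1 show ?thesis by fastforce
      qed
    next
      case (2 i' j')
      have "i' = i \<longrightarrow> Suc j' \<le> Suc j" using x 2 by auto
      then have "i' = i \<longrightarrow> j' \<le> Suc j" "j' \<le> L i'" using 2 by auto
      with 2 show ?thesis by blast
    qed
  qed
  with k(2) have "p i k \<in> ?X" by blast
  then obtain i' j' where "i' < l" "j' \<le> L i'" "i' = i \<longrightarrow> j' \<le> Suc j" "p i k = p i' j'" by blast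
  with k ij show ?thesis by auto
qed

text \<open>A leaf at the inner end blocks the way towards the torso, so the subtree is a piece of a
  single leg. For \<open>j = 0\<close> the leaf is the torso itself, and the other legs are cut
  off.\<close>

lemma inner_leaf_bound:
  assumes S: "subtree S T" and ij: "i < l" "j < L i" "{p i j, p i (Suc j)} \<in> edges S"
    and deg: "vdegree S (p i j) = 1"
  shows "verts S \<subseteq> {p i k | k. j \<le> k \<and> k \<le> L i}"
proof (rule connected_closed_subset)
  show "graph_connected S" by (rule subtree_facts[OF S])
  show "p i j \<in> verts S" using subtree_edge_verts[OF S ij(3)] by blast
  show "p i j \<in> {p i k | k. j \<le> k \<and> k \<le> L i}" using ij by fastforce
next
  fix x y assume x: "x \<in> {p i k | k. j \<le> k \<and> k \<le> L i}" and xy: "{x, y} \<in> edges S"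
  then have xyT: "{x, y} \<in> edges T" using subtree_facts[OF S] by blast
  from x obtain k where k: "x = p i k" "j \<le> k" "k \<le> L i" by blast
  show "y \<in> {p i k | k. j \<le> k \<and> k \<le> L i}"
  proof (cases "k = j")
    case True
    with xy k vdegree_1_unique[OF deg] ij have "y = p i (Suc j)" by blast
    then show ?thesis using ij by fastforce
  next
    case False
    with k have "j < k" by simp
    then have "y = p i (k - 1) \<or> k < L i \<and> y = p i (Suc k)"
      using edge_at_inner[OF xyT[unfolded k]] k ij by auto
    then show ?thesis using \<open>j < k\<close> k by fastforce
  qed
qed

text \<open>Leaf edges are classified by the end that has degree 1; here it is the end away from the
  torso.\<close>

definition outer_leaf :: "'a ugraph \<Rightarrow> nat \<Rightarrow> nat \<Rightarrow> bool" where
  "outer_leaf S i j \<longleftrightarrow> i < l \<and> j < L i \<and> {p i j, p i (Suc j)} \<in> edges S \<and>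
     vdegree S (p i (Suc j)) = 1"

text \<open>Each of two outer leaves on the same leg bounds the depth of the other.\<close>

lemma outer_leaf_unique:
  assumes S: "subtree S T" and "outer_leaf S i j" "outer_leaf S i k"
  shows "j = k"
proof -
  have "p i (Suc j) \<in> verts S" "p i (Suc k) \<in> verts S"
    using assms(2,3) by (auto simp: outer_leaf_def dest: subtree_edge_verts[OF S])
  then have "Suc k \<le> Suc j" "Suc j \<le> Suc k"
    using outer_leaf_bound[OF S, of i j "Suc k"] outer_leaf_bound[OF S, of i k "Suc j"] assms(2,3)
    unfolding outer_leaf_def by simp_all
  then show ?thesis by simp
qed

lemma leaf_edge_cases:
  assumes "subtree S T" "e \<in> leaf_edges S"
  obtains i j where "e = {p i j, p i (Suc j)}" "outer_leaf S i j"
    | i j where "e = {p i j, p i (Suc j)}" "i < l" "j < L i" "e \<in> edges S" "vdegree S (p i j) = 1"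
proof -
  from assms obtain i j where "i < l" "j < L i" "e = {p i j, p i (Suc j)}"
    unfolding leaf_edges_def subtree_def T_eq leg_graph_edges by blast
  with assms(2) that show ?thesis by (auto simp: leaf_edges_def outer_leaf_def)
qed

text \<open>Every leg carries at most one outer leaf edge. An inner leaf would leave at most two
  leaf edges in all, fewer than \<open>l\<close>. Hence \<open>l\<close> leaf edges force an outer
  leaf on every leg.\<close>

lemma many_leaf_edges:
  assumes S: "subtree S T" and card: "l \<le> card (leaf_edges S)"
  shows "card (leaf_edges S) = l" "\<forall>i<l. \<exists>j. outer_leaf S i j"
proof -
  \<comment> \<open>On a leg without an outer leaf this value is arbitrary; such legs are left out
    of \<open>I\<close>.\<close>
  define J where "J i = (SOME j. outer_leaf S i j)" for i
  define I where "I = {i. i < l \<and> (\<exists>j. outer_leaf S i j)}"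
  define e where "e i = {p i (J i), p i (Suc (J i))}" for i
  have J: "J i = j" if "outer_leaf S i j" for i j
    using outer_leaf_unique[OF S that] that unfolding J_def by (metis someI_ex)
  have "leaf_edges S \<subseteq> e ` I"
  proof
    fix f assume f: "f \<in> leaf_edges S"
    from S f show "f \<in> e ` I"
    proof (cases rule: leaf_edge_cases)
      case (1 i j)
      then have "i \<in> I" "f = e i" using J unfolding I_def e_def outer_leaf_def by auto
      then show ?thesis by simp
    next
      case (2 i j)
      \<comment> \<open>\<open>S\<close> is then a path inside leg \<open>i\<close>, which has at most two leaf edges.\<close>
      have in_leg: "verts S \<subseteq> {p i k | k. j \<le> k \<and> k \<le> L i}"
        using inner_leaf_bound[OF S] 2 by blast
      \<comment> \<open>\<open>f\<close> is the only inner leaf edge, and \<open>e i\<close> the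
        only candidate for an outer one; it need not actually be a leaf edge.\<close>
      have "leaf_edges S \<subseteq> {f, e i}"
      proof
        fix g assume g: "g \<in> leaf_edges S"
        from S g show "g \<in> {f, e i}"
        proof (cases rule: leaf_edge_cases)
          case (1 i' j')
          then have "p i' (Suc j') \<in> verts S" "i' < l" "j' < L i'"
            by (auto simp: outer_leaf_def dest: subtree_edge_verts[OF S])
          with in_leg 2 have "i' = i" by auto
          then show ?thesis using 1 J[of i j'] by (simp add: e_def)
        next
          case g2: (2 i' j')
          then have v: "p i' (Suc j') \<in> verts S" "p i' j' \<in> verts S"
            using subtree_edge_verts[OF S] by blast+
          with in_leg 2 g2 have ii: "i' = i" by auto
          from v(2) in_leg ii 2 g2 have "j \<le> j'" by auto
          have "verts S \<subseteq> {p i k | k. j' \<le> k \<and> k \<le> L i}"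
            using inner_leaf_bound[OF S] g2 ii by blast
          moreover have "p i j \<in> verts S"
            using 2 subtree_edge_verts[OF S] by blast
          ultimately have "j' \<le> j" using 2 by auto
          with \<open>j \<le> j'\<close> ii show ?thesis using 2 g2 by simp
        qed
      qed
      then have "card (leaf_edges S) \<le> card {f, e i}" by (intro card_mono) auto
      also have "\<dots> \<le> 2" by (simp add: card_insert_if)
      finally show ?thesis using card legs by simp
    qed
  qed
  moreover have finI: "finite I" "I \<subseteq> {..<l}" unfolding I_def by auto
  ultimately have "card (leaf_edges S) \<le> card I"
    by (meson card_image_le card_mono finite_imageI le_trans)
  moreover have "card I \<le> l" using card_mono[OF _ finI(2)] by simp
  ultimately have eq: "card (leaf_edges S) = l" "card I = l" using card by auto
  then have "I = {..<l}" using finI card_subset_eq[of "{..<l}" I] by simp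
  then show "\<forall>i<l. \<exists>j. outer_leaf S i j" unfolding I_def by auto
  show "card (leaf_edges S) = l" by (rule eq)
qed

text \<open>The outer leaves fix where each leg of \<open>S\<close> ends. Nothing lies beyond them,
  and connectedness fills in everything between them and the torso.\<close>

lemma subtree_with_all_leaves:
  assumes S: "subtree S T" and card: "l \<le> card (leaf_edges S)"
  shows "\<exists>a \<in> PiE {..<l} (\<lambda>i. {1..L i}). S = leg_graph l p a"
proof -
  obtain J where J: "\<And>i. i < l \<Longrightarrow> outer_leaf S i (J i)"
    using many_leaf_edges[OF assms] by metis
  \<comment> \<open>The successor appears because the leaf is the outer end of its edge; the
    restricted function makes \<open>a\<close> extensional, as \<open>PiE\<close> demands.\<close>
  define a where "a = (\<lambda>i\<in>{..<l}. Suc (J i))"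
  have a: "a i = Suc (J i)" if "i < l" for i using that by (simp add: a_def)
  have JL: "J i < L i" if "i < l" for i using J[OF that] by (simp add: outer_leaf_def)
  have end_in: "p i (a i) \<in> verts S" if "i < l" for i
    using J[OF that] subtree_edge_verts[OF S] unfolding outer_leaf_def a[OF that] by blast
  have bound: "k \<le> a i" if "i < l" "k \<le> L i" "p i k \<in> verts S" for i k
    using J[OF that(1)] outer_leaf_bound[OF S] that unfolding outer_leaf_def a[OF that(1)] by blast
  \<comment> \<open>Without the torso, \<open>S\<close> would be trapped in leg 0, although it
    contains the end of leg 1.\<close>
  have torso: "p 0 0 \<in> verts S"
  proof (rule ccontr)
    assume no: "p 0 0 \<notin> verts S"
    have "verts S \<subseteq> {p 0 j | j. 0 < j \<and> j \<le> L 0}"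
    proof (rule connected_closed_subset)
      show "graph_connected S" by (rule subtree_facts[OF S])
      show "p 0 (a 0) \<in> verts S" using end_in[of 0] legs by simp
      show "p 0 (a 0) \<in> {p 0 j | j. 0 < j \<and> j \<le> L 0}"
        using a[of 0] JL[of 0] legs by fastforce
    next
      fix x y assume x: "x \<in> {p 0 j | j. 0 < j \<and> j \<le> L 0}" and xy: "{x, y} \<in> edges S"
      then have xyT: "{x, y} \<in> edges T" using subtree_facts[OF S] by blast
      from x obtain j where j: "x = p 0 j" "0 < j" "j \<le> L 0" by blast
      have "0 < l" using legs by simp
      then have "y = p 0 (j - 1) \<or> j < L 0 \<and> y = p 0 (Suc j)"
        using edge_at_inner[OF xyT[unfolded j]] j by simp
      moreover have "y \<noteq> p 0 0"
        using no xy subtree_edge_verts[OF S] by blast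
      ultimately show "y \<in> {p 0 j | j. 0 < j \<and> j \<le> L 0}"
        using j by (cases "j = 1") fastforce+
    qed
    moreover have "p 1 (a 1) \<in> verts S" using end_in[of 1] legs by simp
    moreover have "a 1 \<le> L 1" "1 < l" "0 < l" using a[of 1] JL[of 1] legs by simp_all
    ultimately show False by auto
  qed
  \<comment> \<open>A missing edge below the end of leg \<open>i\<close> would trap \<open>S\<close>
    in the outer part of that leg, away from the torso.\<close>
  have edge_in: "{p i j, p i (Suc j)} \<in> edges S" if ij: "i < l" "j < a i" for i j
  proof (rule ccontr)
    assume no: "{p i j, p i (Suc j)} \<notin> edges S"
    have "verts S \<subseteq> {p i k | k. j < k \<and> k \<le> L i}"
    proof (rule connected_closed_subset)
      show "graph_connected S" by (rule subtree_facts[OF S])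
      show "p i (a i) \<in> verts S" using end_in ij by simp
      show "p i (a i) \<in> {p i k | k. j < k \<and> k \<le> L i}" using ij a JL by fastforce
    next
      fix x y assume x: "x \<in> {p i k | k. j < k \<and> k \<le> L i}" and xy: "{x, y} \<in> edges S"
      then have xyT: "{x, y} \<in> edges T" using subtree_facts[OF S] by blast
      from x obtain k where k: "x = p i k" "j < k" "k \<le> L i" by blast
      have "y = p i (k - 1) \<or> k < L i \<and> y = p i (Suc k)"
        using edge_at_inner[OF xyT[unfolded k]] k ij by simp
      then show "y \<in> {p i k | k. j < k \<and> k \<le> L i}"
      proof
        assume y: "y = p i (k - 1)"
        have "k \<noteq> Suc j" using no xy y k by (auto simp: insert_commute)
        then have "j < k - 1" "k - 1 \<le> L i" using k by auto
        with y show ?thesis by blast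
      next
        assume "k < L i \<and> y = p i (Suc k)"
        with k(2) show ?thesis by (auto intro!: exI[of _ "Suc k"])
      qed
    qed
    moreover have "0 < l" using legs by simp
    ultimately show False using torso ij by auto
  qed
  have "verts S = verts (leg_graph l p a)"
  proof
    show "verts S \<subseteq> verts (leg_graph l p a)"
    proof
      fix v assume v: "v \<in> verts S"
      then obtain i j where "i < l" "j \<le> L i" "v = p i j" using subtree_verts_cases[OF S] by blast
      with v bound show "v \<in> verts (leg_graph l p a)" unfolding leg_graph_verts by blast
    qed
    show "verts (leg_graph l p a) \<subseteq> verts S"
    proof
      fix v assume "v \<in> verts (leg_graph l p a)"
      then obtain i j where ij: "v = p i j" "i < l" "j \<le> a i" unfolding leg_graph_verts by blast
      show "v \<in> verts S"
      proof (cases "j = a i")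
        case True
        with ij end_in show ?thesis by simp
      next
        case False
        with ij have "{p i j, p i (Suc j)} \<in> edges S" by (intro edge_in) auto
        then show ?thesis using ij subtree_edge_verts[OF S] by blast
      qed
    qed
  qed
  moreover have "edges S = edges (leg_graph l p a)"
  proof
    show "edges (leg_graph l p a) \<subseteq> edges S" using edge_in unfolding leg_graph_edges by blast
    show "edges S \<subseteq> edges (leg_graph l p a)"
    proof
      fix f assume f: "f \<in> edges S"
      then obtain i j where ij: "f = {p i j, p i (Suc j)}" "i < l" "j < L i"
        using subtree_facts(3)[OF S] unfolding T_eq leg_graph_edges by blast
      then have "p i (Suc j) \<in> verts S" using f subtree_edge_verts[OF S] by blast
      with bound ij have "Suc j \<le> a i" by simp
      then have "j < a i" by simp
      with ij show "f \<in> edges (leg_graph l p a)" unfolding leg_graph_edges by blast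
    qed
  qed
  ultimately have "S = leg_graph l p a" by simp
  moreover have "a \<in> PiE {..<l} (\<lambda>i. {1..L i})"
    using JL by (auto simp: a_def Suc_le_eq)
  ultimately show ?thesis by blast
qed

text \<open>Cutting legs creates no cycle, and the last edge of each leg is a leaf edge. This gives
  at least \<open>l\<close> leaf edges; \<open>many_leaf_edges\<close> gives equality.\<close>

lemma leg_graph_subtree:
  assumes a: "a \<in> PiE {..<l} (\<lambda>i. {1..L i})"
  shows "subtree (leg_graph l p a) T" "edges (leg_graph l p a) \<noteq> {}"
    "card (leaf_edges (leg_graph l p a)) = l"
    "card (edges (leg_graph l p a)) = (\<Sum>i<l. a i)"
proof -
  let ?S = "leg_graph l p a"
  have aL: "1 \<le> a i" "a i \<le> L i" if "i < l" for i using a that by (auto simp: PiE_iff)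
  have edges_sub: "edges ?S \<subseteq> edges T"
    unfolding T_eq leg_graph_edges using aL by (blast intro: order_less_le_trans)
  have verts_sub: "verts ?S \<subseteq> verts T"
    unfolding T_eq leg_graph_verts using aL by (blast intro: order_trans)
  have "simple_graph ?S"
    unfolding simple_graph_def
  proof (intro conjI ballI)
    show "finite (verts ?S)"
      using verts_sub tree finite_subset unfolding tree_def simple_graph_def by blast
    fix f assume f: "f \<in> edges ?S"
    then show "card f = 2" using edges_sub tree unfolding tree_def simple_graph_def by blast
    show "f \<subseteq> verts ?S" using f unfolding leg_graph_edges leg_graph_verts by force
  qed
  moreover have "graph_connected ?S"
    unfolding graph_connected_def
  proof (intro conjI ballI)
    have "0 < l" using legs by simp
    then show "verts ?S \<noteq> {}" unfolding leg_graph_verts by blast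
  qed (rule leg_graph_connected_pair[OF coords])
  moreover have "\<not> graph_cycle ?S q" for q
  proof
    assume "graph_cycle ?S q"
    then have "graph_cycle T q" using edges_sub unfolding graph_cycle_def by blast
    then show False using tree by (auto simp: tree_def)
  qed
  ultimately show sub: "subtree ?S T"
    using edges_sub verts_sub by (simp add: subtree_def tree_def)
  have "{p 0 0, p 0 (Suc 0)} \<in> edges ?S"
    using legs aL[of 0] unfolding leg_graph_edges by (auto intro!: exI[of _ 0])
  then show "edges ?S \<noteq> {}" by blast
  define e where "e i = {p i (a i - 1), p i (a i)}" for i
  have "e i \<in> leaf_edges ?S" if i: "i < l" for i
  proof -
    have "{f \<in> edges ?S. p i (a i) \<in> f} = {e i}"
    proof
      show "{e i} \<subseteq> {f \<in> edges ?S. p i (a i) \<in> f}"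
      proof -
        have "e i = {p i (a i - 1), p i (Suc (a i - 1))}" "a i - 1 < a i"
          using aL[OF i] by (simp_all add: e_def)
        then have "e i \<in> edges ?S" using i unfolding leg_graph_edges by blast
        then show ?thesis by (simp add: e_def)
      qed
      show "{f \<in> edges ?S. p i (a i) \<in> f} \<subseteq> {e i}"
      proof
        fix f assume "f \<in> {f \<in> edges ?S. p i (a i) \<in> f}"
        then obtain i' j' where f: "f = {p i' j', p i' (Suc j')}" "i' < l" "j' < a i'"
          "p i (a i) = p i' j' \<or> p i (a i) = p i' (Suc j')" unfolding leg_graph_edges by blast
        then have "i' = i \<and> a i = Suc j'" using i aL[OF i] aL[OF f(2)] by auto
        then show "f \<in> {e i}" using f by (simp add: e_def)
      qed
    qed
    then show ?thesis
      unfolding leaf_edges_def vdegree_def by (auto simp: e_def intro!: bexI[of _ "p i (a i)"])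
  qed
  then have "e ` {..<l} \<subseteq> leaf_edges ?S" by blast
  moreover have "finite (leaf_edges ?S)"
    using finite_edges[OF \<open>simple_graph ?S\<close>] by (simp add: leaf_edges_def)
  ultimately have "card (e ` {..<l}) \<le> card (leaf_edges ?S)" by (rule card_mono[rotated])
  moreover have "inj_on e {..<l}"
  proof (rule inj_onI)
    fix i i' assume "i \<in> {..<l}" "i' \<in> {..<l}" "e i = e i'"
    then show "i = i'"
      using leg_edge_eq[of i i' "a i - 1" "a i' - 1"] aL[of i] aL[of i'] by (simp add: e_def)
  qed
  ultimately have "l \<le> card (leaf_edges ?S)" by (simp add: card_image)
  then show "card (leaf_edges ?S) = l" by (rule many_leaf_edges(1)[OF sub])
  have "edges ?S = (\<lambda>(i, j). {p i j, p i (Suc j)}) ` Sigma {..<l} (\<lambda>i. {..<a i})"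
    unfolding leg_graph_edges by auto
  moreover have "inj_on (\<lambda>(i, j). {p i j, p i (Suc j)}) (Sigma {..<l} (\<lambda>i. {..<a i}))"
  proof (rule inj_onI, clarify)
    fix i j i' j' assume "i < l" "j < a i" "i' < l" "j' < a i'"
      "{p i j, p i (Suc j)} = {p i' j', p i' (Suc j')}"
    then show "i = i' \<and> j = j'"
      using leg_edge_eq[of i i' j j'] aL[of i] aL[of i'] by auto
  qed
  ultimately show "card (edges ?S) = (\<Sum>i<l. a i)"
    by (simp add: card_image)
qed

text \<open>The end of a leg in one graph must be a vertex of the other, so the cut lengths are
  compared in both directions.\<close>

lemma leg_graph_inj: "inj_on (leg_graph l p) (PiE {..<l} (\<lambda>i. {1..L i}))"
proof -
  have le: "a i \<le> b i"
    if "a \<in> PiE {..<l} (\<lambda>i. {1..L i})" "b \<in> PiE {..<l} (\<lambda>i. {1..L i})"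
      "leg_graph l p a = leg_graph l p b" "i < l" for a b i
  proof -
    have ab: "1 \<le> a i" "a i \<le> L i" "\<And>k. k < l \<Longrightarrow> b k \<le> L k"
      using that by (auto simp: PiE_iff)
    have "p i (a i) \<in> verts (leg_graph l p b)"
      using that(4) unfolding that(3)[symmetric] leg_graph_verts by blast
    then obtain i' j' where "i' < l" "j' \<le> b i'" "p i (a i) = p i' j'"
      unfolding leg_graph_verts by blast
    with ab(3)[of i'] ab(1,2) \<open>i < l\<close> show ?thesis by auto
  qed
  show ?thesis
  proof (rule inj_onI)
    fix a b assume ab: "a \<in> PiE {..<l} (\<lambda>i. {1..L i})" "b \<in> PiE {..<l} (\<lambda>i. {1..L i})"
      "leg_graph l p a = leg_graph l p b"
    show "a = b"
    proof (rule PiE_ext[OF ab(1,2)])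
      fix i assume "i \<in> {..<l}"
      then show "a i = b i" using le[OF ab] le[OF ab(2,1) ab(3)[symmetric]] by (simp add: order_antisym)
    qed
  qed
qed

end

text \<open>Start from all edges at the torso and extend legs as long as possible: connectedness makes
  the legs exhaust the vertices, and acyclicity excludes further edges.\<close>

lemma spider_has_coords:
  assumes "spider T"
  obtains l L p where "spider_coords T l L p"
proof -
  have tree: "tree T" using assms by (simp add: spider_def)
  then have simple: "simple_graph T" and conn: "graph_connected T"
    and acyclic: "\<nexists>q. graph_cycle T q" by (auto simp: tree_def)
  obtain c where c: "c \<in> verts T" "3 \<le> vdegree T c"
    and unique: "\<And>v. v \<in> verts T \<Longrightarrow> 3 \<le> vdegree T v \<Longrightarrow> v = c"
    using assms unfolding spider_def by blast
  define N where "N = {w. {c, w} \<in> edges T}"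
  define l where "l = card N"
  have N_sub: "N \<subseteq> verts T" unfolding N_def using edge_in_verts[OF simple] by blast
  then have finN: "finite N" using simple finite_subset by (auto simp: simple_graph_def)
  have "{e \<in> edges T. c \<in> e} \<subseteq> (\<lambda>w. {c, w}) ` N"
  proof
    fix e assume e: "e \<in> {e \<in> edges T. c \<in> e}"
    then have "card e = 2" using simple by (auto simp: simple_graph_def)
    with e obtain w where "e = {c, w}" by (auto simp: card_2_iff)
    with e show "e \<in> (\<lambda>w. {c, w}) ` N" by (auto simp: N_def)
  qed
  then have "vdegree T c \<le> card N"
    unfolding vdegree_def using finN by (meson card_image_le card_mono finite_imageI le_trans)
  with c have l3: "3 \<le> l" by (simp add: l_def)
  obtain w where w: "bij_betw w {0..<l} N"
    using ex_bij_betw_nat_finite[OF finN] unfolding l_def by blast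
  have w_mem: "{c, w i} \<in> edges T" if "i < l" for i
    using bij_betwE[OF w] that by (auto simp: N_def)
  have w_inj: "w i = w i' \<longleftrightarrow> i = i'" if "i < l" "i' < l" for i i'
    using bij_betw_imp_inj_on[OF w] that by (auto simp: inj_on_def)
  \<comment> \<open>Legs grown so far inside \<open>T\<close>. The last conjunct makes every
    neighbour of the torso the first vertex of a leg.\<close>
  define partial where "partial = (\<lambda>(L, p). (\<forall>i<l. 1 \<le> L i \<and> p i 0 = c) \<and> leg_coords l L p \<and>
     (\<forall>i<l. \<forall>j<L i. {p i j, p i (Suc j)} \<in> edges T) \<and>
     (\<forall>y. {c, y} \<in> edges T \<longrightarrow> (\<exists>i<l. y = p i 1)))"
  define missing where "missing = (\<lambda>(L, p). card (verts T - verts (leg_graph l p L)))"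
  have "partial (\<lambda>_. 1, \<lambda>i j. if j = 0 then c else w i)"
  proof -
    have "\<exists>i<l. y = w i" if "{c, y} \<in> edges T" for y
    proof -
      have "y \<in> w ` {0..<l}" using bij_betw_imp_surj_on[OF w] that by (simp add: N_def)
      then show ?thesis by auto
    qed
    moreover have "w i \<noteq> c" "c \<noteq> w i" if "i < l" for i
      using edge_distinct[OF simple w_mem[OF that]] by auto
    ultimately show ?thesis
      using w_mem w_inj unfolding partial_def leg_coords_def by (auto simp: le_Suc_eq)
  qed
  \<comment> \<open>Fewest uncovered vertices means that the legs cannot be extended; the legs of
    length 1 show that a choice exists.\<close>
  from ex_has_least_nat[of partial, OF this, of missing]
  obtain L p where partial: "partial (L, p)"
    and least: "\<And>L' p'. partial (L', p') \<Longrightarrow> missing (L, p) \<le> missing (L', p')" by auto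
  from partial have pos: "\<And>i. i < l \<Longrightarrow> 1 \<le> L i" and p0: "\<And>i. i < l \<Longrightarrow> p i 0 = c"
    and coords: "leg_coords l L p"
    and edge: "\<And>i j. i < l \<Longrightarrow> j < L i \<Longrightarrow> {p i j, p i (Suc j)} \<in> edges T"
    and nbr: "\<And>y. {c, y} \<in> edges T \<Longrightarrow> \<exists>i<l. y = p i 1"
    unfolding partial_def by auto
  note p_eq = leg_coordsD[OF coords]
  let ?R = "verts (leg_graph l p L)"
  have in_R: "p i j \<in> ?R" if "i < l" "j \<le> L i" for i j
    using that unfolding leg_graph_verts by blast
  have c_R: "c \<in> ?R" using in_R[of 0 0] p0[of 0] l3 by simp
  have R_sub: "?R \<subseteq> verts T"
  proof
    fix v assume "v \<in> ?R"
    then obtain i j where ij: "v = p i j" "i < l" "j \<le> L i" unfolding leg_graph_verts by blast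
    show "v \<in> verts T"
    proof (cases j)
      case 0
      then show ?thesis using ij p0 c by simp
    next
      case (Suc k)
      then show ?thesis using ij edge[of i k] edge_in_verts[OF simple] by simp
    qed
  qed
  have "verts T \<subseteq> ?R"
  proof (rule connected_closed_subset[OF conn c(1) c_R], rule ccontr)
    fix x y assume x: "x \<in> ?R" and xy: "{x, y} \<in> edges T" and y: "y \<notin> ?R"
    obtain i j where ij: "x = p i j" "i < l" "j \<le> L i" using x unfolding leg_graph_verts by blast
    have "j \<noteq> 0"
    proof
      assume "j = 0"
      then have "\<exists>i<l. y = p i 1" using ij p0 xy nbr by simp
      then show False using y in_R pos by blast
    qed
    \<comment> \<open>Inside a leg, \<open>y\<close> would be a third neighbour of \<open>x\<close>,
      which makes \<open>x\<close> a second torso.\<close>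
    have "j = L i"
    proof (rule ccontr)
      assume "j \<noteq> L i"
      then have j: "j < L i" using ij by simp
      have "{x, p i (j - 1)} \<in> edges T" "{x, p i (Suc j)} \<in> edges T"
        using edge[OF ij(2), of "j - 1"] edge[OF ij(2) j] j \<open>j \<noteq> 0\<close> ij(1)
        by (simp_all add: insert_commute)
      moreover have "p i (j - 1) \<noteq> p i (Suc j)" using p_eq[of i i "j - 1" "Suc j"] ij(2) j by simp
      moreover have "p i (j - 1) \<noteq> y" "p i (Suc j) \<noteq> y"
        using y in_R[of i "j - 1"] in_R[of i "Suc j"] ij(2) j by auto
      ultimately have "3 \<le> vdegree T x" using xy by (metis vdegree_ge_3[OF simple])
      then have "x = c" using unique edge_in_verts[OF simple xy] by blast
      then have "p i j = p i 0" using ij p0 by simp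
      then show False using p_eq[of i i j 0] ij \<open>j \<noteq> 0\<close> by simp
    qed
    \<comment> \<open>Leg \<open>i\<close> is prolonged by the uncovered vertex \<open>y\<close>,
      against minimality.\<close>
    define L' where "L' = L(i := Suc (L i))"
    define p' where "p' = p(i := (p i)(Suc (L i) := y))"
    have p'_new: "p' i (Suc (L i)) = y" by (simp add: p'_def)
    have p'_old: "p' k m = p k m" if "m \<le> L k" for k m
      using that by (auto simp: p'_def)
    have L'_cases: "m \<le> L k \<or> k = i \<and> m = Suc (L i)" if "m \<le> L' k" for k m
      using that by (auto simp: L'_def split: if_splits)
    have y_ne: "p k m \<noteq> y" if "k < l" "m \<le> L k" for k m using in_R[OF that] y by blast
    have "leg_coords l L' p'"
      unfolding leg_coords_def
    proof (intro allI impI)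
      fix k k' m m' assume k: "k < l" "k' < l" and m: "m \<le> L' k" "m' \<le> L' k'"
      show "p' k m = p' k' m' \<longleftrightarrow> m = m' \<and> (k = k' \<or> m = 0)"
        using L'_cases[OF m(1)] L'_cases[OF m(2)] p_eq[OF k] y_ne[OF k(1), of m] y_ne[OF k(2), of m']
        by (elim disjE) (auto simp: p'_old p'_new)
    qed
    moreover have "{p' k m, p' k (Suc m)} \<in> edges T" if "k < l" "m < L' k" for k m
    proof -
      from L'_cases[of "Suc m" k] that have "m < L k \<or> k = i \<and> m = L i" by auto
      then show ?thesis
        using edge[OF that(1), of m] xy ij \<open>j = L i\<close> by (auto simp: p'_old p'_new)
    qed
    moreover have "\<exists>k<l. z = p' k 1" if "{c, z} \<in> edges T" for z
      using nbr[OF that] pos by (metis p'_old)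
    moreover have "1 \<le> L' k" "p' k 0 = c" if "k < l" for k
      using pos[OF that] p0[OF that] by (auto simp: L'_def p'_old)
    ultimately have "partial (L', p')" unfolding partial_def by blast
    then have "missing (L, p) \<le> missing (L', p')" by (rule least)
    moreover have "missing (L', p') < missing (L, p)"
    proof -
      have "?R \<subseteq> verts (leg_graph l p' L')"
      proof
        fix v assume "v \<in> ?R"
        then obtain k m where km: "v = p k m" "k < l" "m \<le> L k" unfolding leg_graph_verts by blast
        then have "v = p' k m" "m \<le> L' k" by (auto simp: p'_old L'_def)
        with km(2) show "v \<in> verts (leg_graph l p' L')" unfolding leg_graph_verts by blast
      qed
      moreover have "y \<in> verts (leg_graph l p' L')"
      proof -
        have "y = p' i (Suc (L i))" "Suc (L i) \<le> L' i" by (simp_all add: p'_new L'_def)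
        then show ?thesis using ij(2) unfolding leg_graph_verts by blast
      qed
      moreover have "y \<in> verts T" using edge_in_verts[OF simple xy] by blast
      ultimately have "verts T - verts (leg_graph l p' L') \<subset> verts T - ?R" using y by blast
      moreover have "finite (verts T - ?R)" using simple by (simp add: simple_graph_def)
      ultimately show ?thesis unfolding missing_def by (simp add: psubset_card_mono)
    qed
    ultimately show False by simp
  qed
  with R_sub have verts_eq: "verts T = ?R" by blast
  have "edges (leg_graph l p L) \<subseteq> edges T" using edge unfolding leg_graph_edges by blast
  then have "edges (leg_graph l p L) = edges T"
    by (rule acyclic_connected_subset_edges[OF simple acyclic])
      (simp add: verts_eq leg_graph_connected_pair[OF coords])
  with verts_eq have "T = leg_graph l p L" by simp
  with tree l3 pos coords have "spider_coords T l L p" by unfold_locales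
  with that show ?thesis by blast
qed

section \<open>The top leaf coefficient\<close>

text \<open>The left side extracts the coefficient of \<open>r^m\<close>: the bound variable stands
  for an inner polynomial in \<open>r\<close>, and the result is a polynomial in the outer
  variable.\<close>

lemma leaf_coeff_subtree_poly:
  assumes "tree T"
  shows "map_poly (\<lambda>q. coeff q m) (subtree_poly T) =
    (\<Sum>S | subtree S T \<and> edges S \<noteq> {} \<and> card (leaf_edges S) = m. monom 1 (card (edges S)))"
proof (rule poly_eqI)
  fix k
  let ?A = "{S. subtree S T \<and> edges S \<noteq> {}}"
  have "coeff (map_poly (\<lambda>q. coeff q m) (subtree_poly T)) k =
    (\<Sum>S\<in>?A. if card (leaf_edges S) = m then coeff (monom 1 (card (edges S))) k else 0)"
    by (auto simp: coeff_map_poly subtree_poly_def coeff_sum coeff_monom intro!: sum.cong split: if_splits)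
  also have "\<dots> = (\<Sum>S\<in>{S\<in>?A. card (leaf_edges S) = m}. coeff (monom 1 (card (edges S))) k)"
    by (rule sum.inter_filter[OF finite_subtrees[OF assms], symmetric])
  also have "{S\<in>?A. card (leaf_edges S) = m} = {S. subtree S T \<and> edges S \<noteq> {} \<and> card (leaf_edges S) = m}"
    by auto
  finally show "coeff (map_poly (\<lambda>q. coeff q m) (subtree_poly T)) k = coeff
    (\<Sum>S | subtree S T \<and> edges S \<noteq> {} \<and> card (leaf_edges S) = m. monom 1 (card (edges S))) k"
    by (simp add: coeff_sum)
qed

lemma monom_one_sum: "monom (1::int) (\<Sum>i\<in>A. f i) = (\<Prod>i\<in>A. monom 1 (f i))"
  by (simp add: monom_altdef power_sum)

text \<open>The geometric sum in a form free of division.\<close>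

lemma one_minus_monom_mult_sum:
  "(1 - monom 1 1) * (\<Sum>j=1..n. monom 1 j) = monom 1 1 * (1 - monom 1 n :: int poly)"
proof (induction n)
  case (Suc n)
  have "(1 - monom 1 1) * (\<Sum>j=1..Suc n. monom 1 j :: int poly) =
      (1 - monom 1 1) * (\<Sum>j=1..n. monom 1 j) + (1 - monom 1 1) * monom 1 (Suc n)"
    by (simp add: distrib_left)
  also have "\<dots> = monom 1 1 * (1 - monom 1 (Suc n))"
    unfolding Suc.IH by (simp add: algebra_simps mult_monom)
  finally show ?case .
qed (simp add: monom_0)

context spider_coords
begin

lemma leaf_coeff_above:
  assumes "l < m"
  shows "map_poly (\<lambda>q. coeff q m) (subtree_poly T) = 0"
proof -
  have "{S. subtree S T \<and> edges S \<noteq> {} \<and> card (leaf_edges S) = m} = {}"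
    using many_leaf_edges(1) assms by force
  then show ?thesis by (simp only: leaf_coeff_subtree_poly[OF tree] sum.empty)
qed

text \<open>The relevant subtrees correspond to independent choices of a cut length on each leg, and
  their edge numbers add up, so the generating function factors over the legs.\<close>

lemma leaf_coeff_top:
  "map_poly (\<lambda>q. coeff q l) (subtree_poly T) = (\<Prod>i<l. \<Sum>j=1..L i. monom 1 j)"
proof -
  let ?P = "PiE {..<l} (\<lambda>i. {1..L i})"
  have "{S. subtree S T \<and> edges S \<noteq> {} \<and> card (leaf_edges S) = l} = leg_graph l p ` ?P"
    using subtree_with_all_leaves leg_graph_subtree by (auto simp: image_iff Bex_def)
  then have "map_poly (\<lambda>q. coeff q l) (subtree_poly T) =
      (\<Sum>S\<in>leg_graph l p ` ?P. monom 1 (card (edges S)))"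
    by (simp only: leaf_coeff_subtree_poly[OF tree])
  also have "\<dots> = (\<Sum>a\<in>?P. monom 1 (card (edges (leg_graph l p a))))"
    by (simp only: sum.reindex[OF leg_graph_inj] comp_def)
  also have "\<dots> = (\<Sum>a\<in>?P. \<Prod>i<l. monom 1 (a i))"
    by (intro sum.cong) (simp_all add: leg_graph_subtree(4) monom_one_sum)
  also have "\<dots> = (\<Prod>i<l. \<Sum>j=1..L i. monom 1 j)"
    by (rule prod_sum_PiE[symmetric]) auto
  finally show ?thesis .
qed

lemma leaf_coeff_top_times:
  "(1 - monom 1 1) ^ l * map_poly (\<lambda>q. coeff q l) (subtree_poly T) =
    monom 1 1 ^ l * (\<Prod>n\<in>#mset (map L [0..<l]). 1 - monom 1 n)"
proof -
  have "(1 - monom 1 1) ^ l * (\<Prod>i<l. \<Sum>j=1..L i. monom 1 j) =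
      (\<Prod>i<l. (1 - monom 1 1) * (\<Sum>j=1..L i. monom 1 j :: int poly))"
    by (simp add: prod.distrib)
  also have "\<dots> = monom 1 1 ^ l * (\<Prod>i<l. 1 - monom 1 (L i))"
    by (simp only: one_minus_monom_mult_sum prod.distrib prod_constant card_lessThan)
  also have "(\<Prod>i<l. 1 - monom 1 (L i) :: int poly) = (\<Prod>n\<in>#mset (map L [0..<l]). 1 - monom 1 n)"
    by (simp add: prod_unfold_prod_mset multiset.map_comp comp_def lessThan_atLeast0)
  finally show ?thesis by (simp only: leaf_coeff_top)
qed

text \<open>Together with \<open>leaf_coeff_above\<close> this makes \<open>l\<close> the exact
  degree in \<open>r\<close>.\<close>

lemma leaf_coeff_top_nonzero: "map_poly (\<lambda>q. coeff q l) (subtree_poly T) \<noteq> 0"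
proof -
  have "(\<Sum>j=1..L i. monom 1 j) \<noteq> (0 :: int poly)" if "i < l" for i
  proof -
    have "coeff (\<Sum>j=1..L i. monom (1::int) j) 1 = 1"
      using pos[OF that] by (simp add: coeff_sum)
    then show ?thesis by (metis coeff_0 zero_neq_one)
  qed
  then show ?thesis unfolding leaf_coeff_top by simp
qed

end

section \<open>Isomorphism from a length-preserving matching of the legs\<close>

lemma spider_coords_isomorphic:
  assumes "spider_coords T l L p" "spider_coords T' l L' p'"
    and \<pi>: "bij_betw \<pi> {..<l} {..<l}" and L: "\<And>i. i < l \<Longrightarrow> L i = L' (\<pi> i)"
  shows "graph_isomorphic T T'"
proof -
  interpret A: spider_coords T l L p by fact
  interpret B: spider_coords T' l L' p' by fact
  have \<pi>_less: "\<pi> i < l" if "i < l" for i using bij_betwE[OF \<pi>] that by auto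
  have \<pi>_eq: "\<pi> i = \<pi> i' \<longleftrightarrow> i = i'" if "i < l" "i' < l" for i i'
    using bij_betw_imp_inj_on[OF \<pi>] that by (auto simp: inj_on_def)
  have \<pi>_surj: "\<exists>k<l. i = \<pi> k" if "i < l" for i
    using bij_betw_imp_surj_on[OF \<pi>] that by (auto simp: image_iff)
  have p_eq: "p i j = p i' j' \<longleftrightarrow> p' (\<pi> i) j = p' (\<pi> i') j'"
    if "i < l" "i' < l" "j \<le> L i" "j' \<le> L i'" for i i' j j'
    using that \<pi>_less \<pi>_eq L by auto
  \<comment> \<open>The torso has a coordinate pair on every leg, so the image is chosen;
    \<open>p_eq\<close> shows that it does not depend on the pair.\<close>
  define f where "f v = (SOME u. \<exists>i j. i < l \<and> j \<le> L i \<and> v = p i j \<and> u = p' (\<pi> i) j)" for v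
  have f: "f (p i j) = p' (\<pi> i) j" if ij: "i < l" "j \<le> L i" for i j
  proof -
    have "\<exists>i' j'. i' < l \<and> j' \<le> L i' \<and> p i j = p i' j' \<and> f (p i j) = p' (\<pi> i') j'"
      unfolding f_def by (rule someI_ex) (use ij in blast)
    then show ?thesis using p_eq[OF ij(1) _ ij(2)] by metis
  qed
  have vT: "verts T = {p i j | i j. i < l \<and> j \<le> L i}"
    and vT': "verts T' = {p' i j | i j. i < l \<and> j \<le> L' i}"
    by (simp_all add: A.T_eq B.T_eq leg_graph_verts)
  have inj: "inj_on f (verts T)"
    unfolding vT using f p_eq by (auto simp: inj_on_def)
  have "f ` verts T = verts T'"
  proof
    show "f ` verts T \<subseteq> verts T'"
    proof
      fix u assume "u \<in> f ` verts T"
      then obtain i j where ij: "i < l" "j \<le> L i" "u = p' (\<pi> i) j" unfolding vT using f by auto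
      then have "\<pi> i < l" "j \<le> L' (\<pi> i)" using \<pi>_less L by auto
      with ij show "u \<in> verts T'" unfolding vT' by blast
    qed
    show "verts T' \<subseteq> f ` verts T"
    proof
      fix u assume "u \<in> verts T'"
      then obtain i j where "i < l" "j \<le> L' i" "u = p' i j" unfolding vT' by blast
      then obtain k where k: "k < l" "j \<le> L k" "u = p' (\<pi> k) j" using \<pi>_surj L by metis
      then have "u = f (p k j)" "p k j \<in> verts T" using f unfolding vT by auto
      then show "u \<in> f ` verts T" by blast
    qed
  qed
  with inj have bij: "bij_betw f (verts T) (verts T')" by (simp add: bij_betw_def)
  have "{u, v} \<in> edges T \<longleftrightarrow> {f u, f v} \<in> edges T'" if uv: "u \<in> verts T" "v \<in> verts T" for u v
  proof
    have fwd: "{f (p i j), f (p i (Suc j))} \<in> edges T'" if "i < l" "j < L i" for i j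
      using B.leg_edge_in_T[of "\<pi> i" j] f \<pi>_less L that by simp
    assume "{u, v} \<in> edges T"
    then show "{f u, f v} \<in> edges T'"
      by (cases rule: A.edge_cases) (use fwd in \<open>auto simp: insert_commute\<close>)
  next
    \<comment> \<open>An edge of \<open>T'\<close> is lifted along the surjective
      \<open>\<pi>\<close>; injectivity of \<open>f\<close> identifies its ends with
      \<open>u\<close> and \<open>v\<close>.\<close>
    have bwd: "{u, v} \<in> edges T"
      if ij: "i < l" "j < L' i" "f u = p' i j" "f v = p' i (Suc j)" "u \<in> verts T" "v \<in> verts T" for u v i j
    proof -
      obtain k where k: "k < l" "i = \<pi> k" using \<pi>_surj[OF ij(1)] by blast
      have jk: "j < L k" using ij(2) L[OF k(1)] k(2) by simp
      have "f (p k j) = p' i j" unfolding k(2) by (rule f) (use k(1) jk in simp_all)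
      moreover have "f (p k (Suc j)) = p' i (Suc j)" unfolding k(2) by (rule f) (use k(1) jk in simp_all)
      moreover have "p k j \<in> verts T" "p k (Suc j) \<in> verts T"
        using edge_in_verts[OF _ A.leg_edge_in_T[OF k(1) jk]] A.tree by (auto simp: tree_def)
      ultimately have "u = p k j" "v = p k (Suc j)"
        using inj_onD[OF inj, of u "p k j"] inj_onD[OF inj, of v "p k (Suc j)"] ij(3-6) by auto
      then show ?thesis using A.leg_edge_in_T[OF k(1) jk] by simp
    qed
    assume "{f u, f v} \<in> edges T'"
    then show "{u, v} \<in> edges T"
    proof (cases rule: B.edge_cases)
      case (1 i j)
      then show ?thesis using bwd uv by blast
    next
      case (2 i j)
      then have "{v, u} \<in> edges T" using bwd uv by blast
      then show ?thesis by (simp add: insert_commute)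
    qed
  qed
  with bij show ?thesis unfolding graph_isomorphic_def by blast
qed

theorem theorem3p1:
  fixes T :: "'a ugraph" and T' :: "'b ugraph"
  assumes "spider T" and "spider T'"
    and "subtree_poly T = subtree_poly T'"
  shows "graph_isomorphic T T'"
proof -
  obtain l L p where A: "spider_coords T l L p" using spider_has_coords[OF assms(1)] .
  obtain l' L' p' where B': "spider_coords T' l' L' p'" using spider_has_coords[OF assms(2)] .
  \<comment> \<open>If the leg numbers differed, the coefficient at the larger one would be zero for
    one spider and nonzero for the other.\<close>
  have "\<not> l < l'" "\<not> l' < l"
    using spider_coords.leaf_coeff_above[OF A, of l'] spider_coords.leaf_coeff_top_nonzero[OF B']
      spider_coords.leaf_coeff_above[OF B', of l] spider_coords.leaf_coeff_top_nonzero[OF A]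
      assms(3) by auto
  then have "l' = l" by simp
  with B' have B: "spider_coords T' l L' p'" by simp
  have nz: "monom 1 1 ^ l \<noteq> (0 :: int poly)" by simp
  have "(\<Prod>n\<in>#mset (map L [0..<l]). 1 - monom 1 n :: int poly) =
      (\<Prod>n\<in>#mset (map L' [0..<l]). 1 - monom 1 n)"
    using spider_coords.leaf_coeff_top_times[OF A] spider_coords.leaf_coeff_top_times[OF B]
      assms(3) mult_left_cancel[OF nz] by metis
  moreover have "0 \<notin># mset (map L [0..<l])" "0 \<notin># mset (map L' [0..<l])"
    using spider_coords.pos[OF A] spider_coords.pos[OF B] by fastforce+
  ultimately have "mset (map L [0..<l]) = mset (map L' [0..<l])"
    by (rule prod_one_minus_monom_inject)
  \<comment> \<open>Equality of the multisets of leg lengths yields the permutation that matches the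
    legs.\<close>
  then obtain \<pi> where \<pi>: "\<pi> permutes {..<length (map L' [0..<l])}"
    "permute_list \<pi> (map L' [0..<l]) = map L [0..<l]"
    by (rule mset_eq_permutation)
  then have perm: "\<pi> permutes {..<l}" by simp
  have "L i = L' (\<pi> i)" if "i < l" for i
  proof -
    have "\<pi> i < l" using permutes_in_image[OF perm, of i] that by simp
    then show ?thesis
      using permute_list_nth[OF \<pi>(1), of i] that unfolding \<pi>(2) by simp
  qed
  then show ?thesis
    by (rule spider_coords_isomorphic[OF A B permutes_imp_bij[OF perm]])
qed

end
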